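(* Let $f:\mathbb{R}^n\to\mathbb{R}$ be convex and $L$-smooth with a minimizer $x^*$, $f^*=f(x^* )$, let $x^0\in\mathbb{R}^n$, $R=\|x^0-x^*\|_2$, let $\widetilde\nabla f$ satisfy the relative noise condition with parameter $0\le\alpha<1/2$, and let $0<\varepsilon<LR^2$. Then gradient descent combined with the regularization technique solves the problem with precision $\varepsilon$: there are a regularization parameter $\mu>0$ and a step size $h>0$, depending only on $L,R,\alpha,\varepsilon$, such that the iterates $$x^{k}=x^{k-1}-h\,\widetilde\nabla f_\mu(x^{k-1}),\qquad k\ge1,$$ satisfy $f(x^N)-f^*\le\varepsilon$ for some number of iterations $$N\le12\,\frac{(1+\alpha)^2}{(1-\alpha)^6}\,\frac{LR^2}{\varepsilon}\,\ln\left(\frac{2LR^2}{\varepsilon}\right)+1.$$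
   Context: $\|\cdot\|_2$ is the Euclidean norm; $f$ is differentiable. Convex: $f(x)+\langle\nabla f(x),y-x\rangle\le f(y)$ for all $x,y$. $L$-smooth: $f(y)\le f(x)+\langle\nabla f(x),y-x\rangle+\frac L2\|x-y\|_2^2$ for all $x,y$. Relative noise condition with parameter $\alpha$: $\|\widetilde\nabla f(x)-\nabla f(x)\|_2\le\alpha\|\nabla f(x)\|_2$ for all $x\in\mathbb{R}^n$. Regularization technique: instead of $f$ one applies the method to $f_\mu(x\,|\,x^0)=f(x)+\frac\mu2\|x-x^0\|_2^2$, with gradient estimate $\widetilde\nabla f_\mu(x)=\widetilde\nabla f(x)+\mu(x-x^0)$. *)

theory Defs
  imports Complex_Main "Jordan_Normal_Form.Matrix"
begin

text \<open>The parameters \<open>\<mu>\<close> and \<open>h\<close> may not depend on the dimension \<open>n\<close>, so \<open>n\<close> has to be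
  quantified inside the formula: \<open>\<real>\<^sup>n\<close> is the carrier \<^term>\<open>carrier_vec n :: real vec set\<close>, and
  the values of functions outside the carrier are irrelevant.\<close>

definition norm2 :: "real vec \<Rightarrow> real" where
  "norm2 v = sqrt (v \<bullet> v)"

text \<open>Frechet differentiability on all of \<open>\<real>\<^sup>n\<close>, with \<open>g x\<close> the (unique) gradient at \<open>x\<close>.\<close>

definition has_gradient :: "nat \<Rightarrow> (real vec \<Rightarrow> real) \<Rightarrow> (real vec \<Rightarrow> real vec) \<Rightarrow> bool" where
  "has_gradient n f g \<longleftrightarrow>
     (\<forall>x \<in> carrier_vec n. g x \<in> carrier_vec n \<and>
        (\<forall>e > 0. \<exists>d > 0. \<forall>y \<in> carrier_vec n. norm2 (y - x) < d \<longrightarrow>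
           \<bar>f y - f x - g x \<bullet> (y - x)\<bar> \<le> e * norm2 (y - x)))"

definition convex_fun :: "nat \<Rightarrow> (real vec \<Rightarrow> real) \<Rightarrow> (real vec \<Rightarrow> real vec) \<Rightarrow> bool" where
  "convex_fun n f g \<longleftrightarrow>
     (\<forall>x \<in> carrier_vec n. \<forall>y \<in> carrier_vec n. f x + g x \<bullet> (y - x) \<le> f y)"

definition L_smooth :: "nat \<Rightarrow> real \<Rightarrow> (real vec \<Rightarrow> real) \<Rightarrow> (real vec \<Rightarrow> real vec) \<Rightarrow> bool" where
  "L_smooth n L f g \<longleftrightarrow>
     (\<forall>x \<in> carrier_vec n. \<forall>y \<in> carrier_vec n.
        f y \<le> f x + g x \<bullet> (y - x) + L / 2 * (norm2 (x - y))\<^sup>2)"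

definition relative_noise :: "nat \<Rightarrow> real \<Rightarrow> (real vec \<Rightarrow> real vec) \<Rightarrow> (real vec \<Rightarrow> real vec) \<Rightarrow> bool" where
  "relative_noise n \<alpha> g gt \<longleftrightarrow>
     (\<forall>x \<in> carrier_vec n. gt x \<in> carrier_vec n \<and> norm2 (gt x - g x) \<le> \<alpha> * norm2 (g x))"

text \<open>Gradient estimate for \<open>f x + \<mu> / 2 * (norm2 (x - x0))\<^sup>2\<close>, from an estimate \<open>gt\<close> for \<open>f\<close>.\<close>

definition reg_estimate :: "(real vec \<Rightarrow> real vec) \<Rightarrow> real \<Rightarrow> real vec \<Rightarrow> real vec \<Rightarrow> real vec" where
  "reg_estimate gt \<mu> x0 x = gt x + \<mu> \<cdot>\<^sub>v (x - x0)"

primrec gd :: "(real vec \<Rightarrow> real vec) \<Rightarrow> real \<Rightarrow> real vec \<Rightarrow> nat \<Rightarrow> real vec" where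
  "gd G h x0 0 = x0"
| "gd G h x0 (Suc k) = gd G h x0 k - h \<cdot>\<^sub>v G (gd G h x0 k)"

end

theory Submission
  imports Defs
begin

text \<open>Take \<open>\<mu> = \<epsilon> / R\<^sup>2\<close> and \<open>h = 1 / (L + \<mu>)\<close>, and let \<open>F\<close> be the regularized function, \<open>G\<close> its
  gradient and \<open>e\<close> the error of the gradient estimate. Smoothness gives
  \<open>F x' \<le> F x - h / 2 * (|G|\<^sup>2 - |e|\<^sup>2)\<close> for a step from \<open>x\<close> to \<open>x'\<close>. The noise is relative to the
  gradient \<open>g\<close> of \<open>f\<close> rather than to \<open>G\<close>, but \<open>|g|\<^sup>2 \<le> 2 |G|\<^sup>2\<close> as long as \<open>f x - f\<^sup>* > \<epsilon>\<close>, so that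
  \<open>|e|\<^sup>2 \<le> 2 \<alpha>\<^sup>2 |G|\<^sup>2 \<le> |G|\<^sup>2 / 2\<close>. By strong convexity \<open>|G|\<^sup>2\<close> is at least \<open>2 \<mu>\<close> times the excess
  \<open>F x - F x\<^sup>*\<close>, where \<open>x\<^sup>*\<close> is the minimizer of \<open>f\<close> (not of \<open>F\<close>) and \<open>F x\<^sup>* = f\<^sup>* + \<epsilon> / 2\<close>. Hence
  the excess contracts by the factor \<open>1 - h * \<mu> / 2\<close> in each step until \<open>f x - f\<^sup>* \<le> \<epsilon>\<close>.\<close>

lemma scalar_prod_self_nonneg: "0 \<le> v \<bullet> (v :: real vec)"
  by (simp add: scalar_prod_def sum_nonneg)

lemma norm2_square: "(norm2 v)\<^sup>2 = v \<bullet> v"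
  by (simp add: norm2_def scalar_prod_self_nonneg)

lemma norm2_nonneg: "0 \<le> norm2 v"
  by (simp add: norm2_def scalar_prod_self_nonneg)

lemma scalar_prod_diff_smult_self:
  fixes a b :: "real vec"
  assumes "a \<in> carrier_vec n" "b \<in> carrier_vec n"
  shows "(a - c \<cdot>\<^sub>v b) \<bullet> (a - c \<cdot>\<^sub>v b) = a \<bullet> a - 2 * c * (a \<bullet> b) + c\<^sup>2 * (b \<bullet> b)"
proof -
  have "b \<bullet> a = a \<bullet> b"
    using assms by (simp add: comm_scalar_prod[of _ n])
  then show ?thesis
    using assms
    by (simp add: minus_scalar_prod_distrib[of _ n] scalar_prod_minus_distrib[of _ n]
        power2_eq_square algebra_simps)
qed

text \<open>Young's inequality, read off from \<open>|a - c b|^2 >= 0\<close>. The free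
  \<open>c\<close> gets the values \<open>2 * \<mu>\<close> and \<open>\<mu>\<close> below.\<close>

lemma two_smult_scalar_prod_le:
  fixes a b :: "real vec"
  assumes "a \<in> carrier_vec n" "b \<in> carrier_vec n"
  shows "2 * c * (a \<bullet> b) \<le> a \<bullet> a + c\<^sup>2 * (b \<bullet> b)"
  using scalar_prod_self_nonneg[of "a - c \<cdot>\<^sub>v b"] scalar_prod_diff_smult_self[OF assms, of c]
  by simp

lemma scalar_prod_self_eq_0D:
  fixes v :: "real vec"
  assumes "v \<bullet> v = 0" "v \<in> carrier_vec n"
  shows "v = 0\<^sub>v n"
proof -
  have "(\<Sum>i = 0..<n. v $ i * v $ i) = 0"
    using assms by (simp add: scalar_prod_def)
  then have "\<forall>i \<in> {0..<n}. v $ i * v $ i = 0"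
    by (subst (asm) sum_nonneg_eq_0_iff) auto
  then show ?thesis
    using assms(2) by (intro eq_vecI) auto
qed

text \<open>By smoothness, a step of length \<open>1 / L\<close> along the negative gradient lowers
  \<open>f\<close> by at least \<open>|g xs|^2 / (2 * L)\<close>, which minimality forces to
  vanish.\<close>

lemma gradient_minimizer_eq_0:
  assumes sm: "L_smooth n L f g" and L: "0 < L"
    and xs: "xs \<in> carrier_vec n" and gx: "g xs \<in> carrier_vec n"
    and min: "\<forall>x \<in> carrier_vec n. f xs \<le> f x"
  shows "g xs = 0\<^sub>v n"
proof -
  define y where "y = xs - (1/L) \<cdot>\<^sub>v g xs"
  have y: "y \<in> carrier_vec n" using xs gx by (simp add: y_def)
  have d: "y - xs = - ((1/L) \<cdot>\<^sub>v g xs)" "xs - y = (1/L) \<cdot>\<^sub>v g xs"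
    using xs gx by (auto simp: y_def)
  have "f xs \<le> f y" using min y by blast
  also have "f y \<le> f xs + g xs \<bullet> (y - xs) + L / 2 * (norm2 (xs - y))\<^sup>2"
    using sm xs y by (simp add: L_smooth_def)
  also have "\<dots> = f xs - (g xs \<bullet> g xs) / (2 * L)"
    using gx L by (simp add: d norm2_square)
  finally have "(g xs \<bullet> g xs) / (2 * L) \<le> 0" by simp
  then have "g xs \<bullet> g xs = 0"
    using L scalar_prod_self_nonneg[of "g xs"] by (simp add: divide_le_0_iff)
  then show ?thesis
    by (rule scalar_prod_self_eq_0D) (rule gx)
qed

lemma smooth_minimizer_gap:
  assumes sm: "L_smooth n L f g" and L: "0 < L"
    and xs: "xs \<in> carrier_vec n" and gx: "g xs \<in> carrier_vec n" and x: "x \<in> carrier_vec n"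
    and min: "\<forall>x \<in> carrier_vec n. f xs \<le> f x"
  shows "f x - f xs \<le> L / 2 * (norm2 (x - xs))\<^sup>2"
proof -
  have "f x \<le> f xs + g xs \<bullet> (x - xs) + L / 2 * (norm2 (xs - x))\<^sup>2"
    using sm xs x by (simp add: L_smooth_def)
  moreover have "g xs \<bullet> (x - xs) = 0"
    using gradient_minimizer_eq_0[OF sm L xs gx min] xs x by simp
  moreover have "norm2 (xs - x) = norm2 (x - xs)"
  proof -
    have "xs - x = - (x - xs)" using xs x by auto
    then show ?thesis using xs x by (simp add: norm2_def)
  qed
  ultimately show ?thesis by simp
qed

text \<open>\<open>E\<close> is the excess of the regularized function over its value at
  \<open>xs\<close>. With \<mu> R^2 = \<epsilon>, the assumption \<open>gap\<close> says that
  precision \<epsilon> has not been surpassed at \<open>x\<close>.\<close>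

lemma regularized_step_contraction:
  fixes f :: "real vec \<Rightarrow> real" and x x0 xs :: "real vec" and \<mu> :: real
  defines "E \<equiv> \<lambda>y. f y - f xs + \<mu> / 2 * (norm2 (y - x0))\<^sup>2 - \<mu> / 2 * (norm2 (x0 - xs))\<^sup>2"
  assumes sm: "L_smooth n L f g" and cv: "convex_fun n f g" and rn: "relative_noise n \<alpha> g gt"
    and x: "x \<in> carrier_vec n" and xs: "xs \<in> carrier_vec n" and x0: "x0 \<in> carrier_vec n"
    and gx: "g x \<in> carrier_vec n"
    and \<alpha>: "0 \<le> \<alpha>" "\<alpha> \<le> 1/2" and \<mu>: "0 < \<mu>" and h: "0 < h" "h * (L + \<mu>) = 1"
    and gap: "\<mu> * (norm2 (x0 - xs))\<^sup>2 \<le> f x - f xs"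
  shows "E (x - h \<cdot>\<^sub>v reg_estimate gt \<mu> x0 x) \<le> (1 - h * \<mu> / 2) * E x"
proof -
  define a t v w where "a = g x" and "t = gt x" and "v = x - x0" and "w = x0 - xs"
  define x' where "x' = x - h \<cdot>\<^sub>v (t + \<mu> \<cdot>\<^sub>v v)"
  have t: "t \<in> carrier_vec n"
    using rn x by (simp add: relative_noise_def t_def)
  have c: "a \<in> carrier_vec n" "t \<in> carrier_vec n" "v \<in> carrier_vec n" "w \<in> carrier_vec n"
    using x xs x0 gx t by (auto simp: a_def v_def w_def)
  have x': "x' \<in> carrier_vec n" using x c by (simp add: x'_def)
  note distribs = scalar_prod_add_distrib[of _ n] add_scalar_prod_distrib[of _ n]
    scalar_prod_minus_distrib[of _ n] minus_scalar_prod_distrib[of _ n]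
    smult_scalar_prod_distrib[of _ n] scalar_prod_smult_distrib[of _ n]
  have comm: "v \<bullet> a = a \<bullet> v" "w \<bullet> a = a \<bullet> w" "t \<bullet> a = a \<bullet> t" "v \<bullet> t = t \<bullet> v"
    using c by (simp_all add: comm_scalar_prod[of _ n])
  have d: "x' - x = - (h \<cdot>\<^sub>v (t + \<mu> \<cdot>\<^sub>v v))" "x - x' = h \<cdot>\<^sub>v (t + \<mu> \<cdot>\<^sub>v v)"
    "x' - x0 = v - h \<cdot>\<^sub>v (t + \<mu> \<cdot>\<^sub>v v)" "xs - x = - (v + w)"
    using x xs x0 c(2) by (auto simp: x'_def v_def w_def algebra_simps)
  \<comment> \<open>In expanded form, \<open>G2 = |a + \<mu> v|^2\<close>,
    \<open>e2 = |t - a|^2\<close> and \<open>P = |t + \<mu> v|^2\<close>. The regularization term is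
    exact, so \<open>t - a\<close> is also the error of the regularized estimate.\<close>
  define G2 where "G2 = a \<bullet> a + 2 * \<mu> * (a \<bullet> v) + \<mu>\<^sup>2 * (v \<bullet> v)"
  define e2 where "e2 = t \<bullet> t - 2 * (a \<bullet> t) + a \<bullet> a"
  define P where "P = t \<bullet> t + 2 * \<mu> * (t \<bullet> v) + \<mu>\<^sup>2 * (v \<bullet> v)"
  have E: "E y = f y - f xs + \<mu> / 2 * ((y - x0) \<bullet> (y - x0)) - \<mu> / 2 * (w \<bullet> w)" for y
    by (simp add: E_def norm2_square w_def)
  have Ex: "E x = f x - f xs + \<mu> / 2 * (v \<bullet> v) - \<mu> / 2 * (w \<bullet> w)"
    by (simp add: E v_def)
  have conv: "f x - f xs \<le> a \<bullet> v + a \<bullet> w"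
  proof -
    have "f x + a \<bullet> (xs - x) \<le> f xs"
      using cv x xs by (simp add: convex_fun_def a_def)
    then show ?thesis using c by (simp add: d distribs)
  qed
  have smooth: "f x' \<le> f x - h * (a \<bullet> t + \<mu> * (a \<bullet> v)) + L / 2 * (h\<^sup>2 * P)"
  proof -
    have "f x' \<le> f x + a \<bullet> (x' - x) + L / 2 * ((x - x') \<bullet> (x - x'))"
      using sm x x' by (simp add: L_smooth_def a_def norm2_square)
    also have "(x - x') \<bullet> (x - x') = h\<^sup>2 * P"
      using c by (simp add: d distribs comm P_def power2_eq_square algebra_simps)
    finally show ?thesis using c by (simp add: d distribs algebra_simps)
  qed
  have dist: "(x' - x0) \<bullet> (x' - x0) = v \<bullet> v - 2 * h * (t \<bullet> v + \<mu> * (v \<bullet> v)) + h\<^sup>2 * P"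
    using c by (simp add: d distribs comm P_def power2_eq_square algebra_simps)
  have noise: "e2 \<le> \<alpha>\<^sup>2 * (a \<bullet> a)"
  proof -
    have "norm2 (t - a) \<le> \<alpha> * norm2 a"
      using rn x by (simp add: relative_noise_def t_def a_def)
    then have "(norm2 (t - a))\<^sup>2 \<le> (\<alpha> * norm2 a)\<^sup>2"
      by (intro power_mono) (simp_all add: norm2_nonneg)
    then show ?thesis
      using c by (simp add: power_mult_distrib norm2_square distribs comm e2_def)
  qed
  have "\<alpha>\<^sup>2 \<le> (1/2)\<^sup>2"
    using \<alpha> by (intro power_mono) auto
  then have "\<alpha>\<^sup>2 * (a \<bullet> a) \<le> (1/4) * (a \<bullet> a)"
    by (intro mult_right_mono scalar_prod_self_nonneg) (simp add: power2_eq_square)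
  \<comment> \<open>Convexity and \<open>gap\<close> give
    \<open>a \<bullet> v >= \<mu> |w|^2 - a \<bullet> w\<close>. Hence \<open>2 * G2 - |a|^2\<close>
    is at least \<open>|a - 2 \<mu> w|^2 + 2 \<mu>^2 |v|^2\<close>.\<close>
  moreover have "a \<bullet> a \<le> 2 * G2"
  proof -
    have "2 * (2 * \<mu>) * (a \<bullet> w) \<le> a \<bullet> a + (2 * \<mu>)\<^sup>2 * (w \<bullet> w)"
      using c by (intro two_smult_scalar_prod_le)
    moreover have "\<mu> * (\<mu> * (w \<bullet> w)) \<le> \<mu> * (a \<bullet> v + a \<bullet> w)"
      using \<mu> gap conv by (intro mult_left_mono) (simp_all add: w_def norm2_square)
    moreover have "0 \<le> \<mu>\<^sup>2 * (v \<bullet> v)"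
      by (simp add: scalar_prod_self_nonneg)
    ultimately show ?thesis
      by (simp add: G2_def power2_eq_square algebra_simps)
  qed
  ultimately have e2: "e2 \<le> G2 / 2" using noise by simp
  \<comment> \<open>By convexity, \<open>G2 - 2 * \<mu> * E x\<close> is at least
    \<open>|a - \<mu> w|^2\<close>.\<close>
  have G2: "2 * \<mu> * E x \<le> G2"
  proof -
    have "2 * \<mu> * (a \<bullet> w) \<le> a \<bullet> a + \<mu>\<^sup>2 * (w \<bullet> w)"
      using c by (intro two_smult_scalar_prod_le)
    moreover have "\<mu> * (f x - f xs) \<le> \<mu> * (a \<bullet> v + a \<bullet> w)"
      using \<mu> conv by (intro mult_left_mono) simp_all
    ultimately show ?thesis
      by (simp add: Ex G2_def power2_eq_square algebra_simps)
  qed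
  have "E x' \<le> E x - h * (a \<bullet> t + \<mu> * (a \<bullet> v)) - h * \<mu> * (t \<bullet> v + \<mu> * (v \<bullet> v))
      + h * (h * (L + \<mu>)) / 2 * P"
    using smooth by (simp add: E[of x'] Ex dist power2_eq_square algebra_simps add_divide_distrib)
  \<comment> \<open>The terms of first order sum to \<open>h\<close> times the inner product of
    \<open>a + \<mu> v\<close> and \<open>t + \<mu> v\<close>, and \<open>P\<close> now has
    coefficient \<open>h / 2\<close>. Polarization turns this into a difference of squares.\<close>
  also have "\<dots> = E x - h / 2 * (G2 - e2)"
    by (simp add: h(2)) (simp add: P_def G2_def e2_def power2_eq_square field_simps)
  also have "\<dots> \<le> E x - h / 2 * (\<mu> * E x)"
    using h(1) e2 G2 by (intro diff_left_mono mult_left_mono) simp_all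
  finally show ?thesis
    by (simp add: x'_def reg_estimate_def t_def v_def algebra_simps)
qed

lemma gd_carrier:
  assumes "x0 \<in> carrier_vec n" "\<And>x. x \<in> carrier_vec n \<Longrightarrow> G x \<in> carrier_vec n"
  shows "gd G h x0 k \<in> carrier_vec n"
  using assms by (induction k) auto

text \<open>The contraction is asked for only before step \<open>N\<close>, because it is available
  only while the precision is not reached.\<close>

lemma gd_geometric_decay:
  fixes E :: "real vec \<Rightarrow> real"
  assumes "\<And>k. k < N \<Longrightarrow> E (gd G h x0 (Suc k)) \<le> q * E (gd G h x0 k)" "0 \<le> q"
  shows "E (gd G h x0 N) \<le> q ^ N * E x0"
  using assms(1)
proof (induction N)
  case (Suc N)
  have "E (gd G h x0 (Suc N)) \<le> q * E (gd G h x0 N)"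
    using Suc.prems by blast
  also have "\<dots> \<le> q * (q ^ N * E x0)"
    using Suc assms(2) by (intro mult_left_mono) auto
  finally show ?case by (simp add: mult_ac)
qed simp

text \<open>Follows from \<open>1 - y <= exp (- y)\<close> with
  \<open>y = 1 / (4 * \<kappa>)\<close>.\<close>

lemma geometric_decay_estimate:
  fixes \<kappa> q :: real
  assumes \<kappa>: "1 < \<kappa>" and q: "0 \<le> q" "q \<le> 1 - 1 / (4 * \<kappa>)" and N: "4 * \<kappa> * ln (2 * \<kappa>) \<le> real N"
  shows "q ^ N \<le> 1 / (2 * \<kappa>)"
proof -
  have "q \<le> exp (- (1 / (4 * \<kappa>)))"
    using q(2) exp_ge_add_one_self[of "- (1 / (4 * \<kappa>))"] by linarith
  then have "q ^ N \<le> exp (- (1 / (4 * \<kappa>))) ^ N"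
    using q(1) by (intro power_mono)
  also have "\<dots> = exp (- (real N / (4 * \<kappa>)))"
    by (simp flip: exp_of_nat_mult)
  also have "\<dots> \<le> exp (- ln (2 * \<kappa>))"
    using \<kappa> N by (simp add: pos_le_divide_eq mult_ac)
  also have "\<dots> = 1 / (2 * \<kappa>)"
    using \<kappa> by (simp add: exp_minus inverse_eq_divide)
  finally show ?thesis .
qed

theorem theorem7p1:
  fixes L R \<alpha> \<epsilon> :: real
  assumes "0 \<le> \<alpha>" and "\<alpha> < 1/2"
    and "0 < \<epsilon>" and "\<epsilon> < L * R\<^sup>2"
  shows "\<exists>\<mu> > 0. \<exists>h > 0.
    \<forall>(n::nat) (f :: real vec \<Rightarrow> real) (g :: real vec \<Rightarrow> real vec) (gt :: real vec \<Rightarrow> real vec)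
     (xs :: real vec) (x0 :: real vec).
      has_gradient n f g \<and> convex_fun n f g \<and> L_smooth n L f g \<and>
      xs \<in> carrier_vec n \<and> (\<forall>x \<in> carrier_vec n. f xs \<le> f x) \<and>
      x0 \<in> carrier_vec n \<and> R = norm2 (x0 - xs) \<and>
      relative_noise n \<alpha> g gt \<longrightarrow>
      (\<exists>N::nat.
         real N \<le> 12 * ((1 + \<alpha>)^2 / (1 - \<alpha>)^6) * (L * R\<^sup>2 / \<epsilon>) * ln (2 * L * R\<^sup>2 / \<epsilon>) + 1 \<and>
         f (gd (reg_estimate gt \<mu> x0) h x0 N) - f xs \<le> \<epsilon>)"
proof -
  have "0 < L * R\<^sup>2" using assms by linarith
  then have L: "0 < L" and R: "0 < R\<^sup>2" by (auto simp: zero_less_mult_iff)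
  define \<mu> where "\<mu> = \<epsilon> / R\<^sup>2"
  define h where "h = 1 / (L + \<mu>)"
  define \<kappa> where "\<kappa> = L * R\<^sup>2 / \<epsilon>"
  define B where "B = 12 * ((1 + \<alpha>)^2 / (1 - \<alpha>)^6) * \<kappa> * ln (2 * \<kappa>)"
  \<comment> \<open>Rounding up accounts for the \<open>+ 1\<close> in the bound.\<close>
  define N where "N = nat \<lceil>B\<rceil>"
  have \<mu>: "0 < \<mu>" "\<mu> * R\<^sup>2 = \<epsilon>" using R assms(3) by (simp_all add: \<mu>_def)
  have h: "0 < h" "h * (L + \<mu>) = 1" using L \<mu> by (simp_all add: h_def)
  have \<kappa>: "1 < \<kappa>" using assms by (simp add: \<kappa>_def)
  \<comment> \<open>Since \<kappa> = L / \<mu>, the product is \<open>1 / (\<kappa> + 1)\<close>.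
    The lower bound puts the contraction factor below \<open>1 - 1 / (4 * \<kappa>)\<close>.\<close>
  have h\<mu>: "1 / (2 * \<kappa>) \<le> h * \<mu>" "h * \<mu> \<le> 1"
  proof -
    have "L = \<mu> * \<kappa>" using assms(3) R by (simp add: \<mu>_def \<kappa>_def)
    then have "h * \<mu> * (\<kappa> + 1) = 1"
      using h(2) by (simp add: algebra_simps)
    then have "h * \<mu> = 1 / (\<kappa> + 1)"
      using \<kappa> by (simp add: eq_divide_eq)
    moreover have "1 / (2 * \<kappa>) \<le> 1 / (\<kappa> + 1)" "1 / (\<kappa> + 1) \<le> 1"
      using \<kappa> by (simp_all add: field_simps)
    ultimately show "1 / (2 * \<kappa>) \<le> h * \<mu>" "h * \<mu> \<le> 1"
      by simp_all
  qed
  have ln_pos: "0 \<le> \<kappa> * ln (2 * \<kappa>)" using \<kappa> by simp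
  \<comment> \<open>The contraction needs \<open>4 * \<kappa> * ln (2 * \<kappa>)\<close> steps;
    \<open>B\<close> exceeds this because its \<alpha>-dependent factor is at least 1.\<close>
  have "1 \<le> (1 + \<alpha>)^2 / (1 - \<alpha>)^6"
  proof -
    have "(1 - \<alpha>)^6 \<le> 1" using assms by (intro power_le_one) auto
    moreover have "1 \<le> (1 + \<alpha>)^2" using assms by (intro one_le_power) auto
    moreover have "0 < (1 - \<alpha>)^6" using assms by simp
    ultimately show ?thesis by (simp only: le_divide_eq_1_pos)
  qed
  then have "12 * 1 * (\<kappa> * ln (2 * \<kappa>)) \<le> 12 * ((1 + \<alpha>)^2 / (1 - \<alpha>)^6) * (\<kappa> * ln (2 * \<kappa>))"
    using ln_pos by (intro mult_right_mono mult_left_mono) auto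
  then have B: "4 * \<kappa> * ln (2 * \<kappa>) \<le> B" "0 \<le> B"
    using ln_pos by (simp_all add: B_def mult_ac)
  then have N: "4 * \<kappa> * ln (2 * \<kappa>) \<le> real N" "real N \<le> B + 1"
    by (simp_all add: N_def) linarith+
  show ?thesis
  proof (rule exI[of _ \<mu>], rule conjI[OF \<mu>(1)], rule exI[of _ h], rule conjI[OF h(1)], clarify)
    fix n f g gt xs x0
    assume gr: "has_gradient n f g" and cv: "convex_fun n f g" and sm: "L_smooth n L f g"
      and xs: "xs \<in> carrier_vec n" and min: "\<forall>x \<in> carrier_vec n. f xs \<le> f x"
      and x0: "x0 \<in> carrier_vec n" and Req: "R = norm2 (x0 - xs)"
      and rn: "relative_noise n \<alpha> g gt"
    define X where "X = gd (reg_estimate gt \<mu> x0) h x0"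
    define E where "E y = f y - f xs + \<mu> / 2 * (norm2 (y - x0))\<^sup>2 - \<mu> / 2 * (norm2 (x0 - xs))\<^sup>2" for y
    have gc: "g x \<in> carrier_vec n" if "x \<in> carrier_vec n" for x
      using gr that by (simp add: has_gradient_def)
    have "gt x \<in> carrier_vec n" if "x \<in> carrier_vec n" for x
      using rn that by (simp add: relative_noise_def)
    then have Xc: "X k \<in> carrier_vec n" for k
      unfolding X_def using x0 by (intro gd_carrier) (auto simp: reg_estimate_def)
    \<comment> \<open>If no iterate up to \<open>N\<close> were good enough, every step would
      contract, leaving an excess of at most \<epsilon> / 4 at \<open>N\<close>. But a gap above
      \<epsilon> keeps the excess above \<epsilon> / 2, since the penalty at \<open>xs\<close> is
      \<epsilon> / 2.\<close>
    have "\<exists>k \<le> N. f (X k) - f xs \<le> \<epsilon>"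
    proof (rule ccontr)
      assume "\<not> ?thesis"
      then have gap: "\<epsilon> < f (X k) - f xs" if "k \<le> N" for k using that by force
      have "E (X (Suc k)) \<le> (1 - h * \<mu> / 2) * E (X k)" if "k < N" for k
        using regularized_step_contraction[OF sm cv rn Xc xs x0 gc[OF Xc], of \<mu> h k]
          gap[of k] that assms \<mu> h Req by (simp add: E_def X_def)
      then have "E (X N) \<le> (1 - h * \<mu> / 2) ^ N * E x0"
        unfolding X_def using h\<mu> by (intro gd_geometric_decay) auto
      also have "\<dots> \<le> 1 / (2 * \<kappa>) * (L / 2 * R\<^sup>2)"
      \<comment> \<open>Multiplying the two bounds requires \<open>E x0\<close> to be nonnegative,
        which the gap at step 0 provides.\<close>
      proof (rule mult_mono')
        show "(1 - h * \<mu> / 2) ^ N \<le> 1 / (2 * \<kappa>)"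
          using h\<mu> by (intro geometric_decay_estimate[OF \<kappa> _ _ N(1)]) (auto simp: field_simps)
        have E0: "E x0 = f x0 - f xs - \<epsilon> / 2"
          using x0 \<mu> Req by (simp add: E_def norm2_def)
        show "E x0 \<le> L / 2 * R\<^sup>2"
          using smooth_minimizer_gap[OF sm L xs gc[OF xs] x0 min] assms(3) Req
          by (simp add: E0)
        show "0 \<le> E x0" using gap[of 0] assms(3) by (simp add: E0 X_def)
        show "0 \<le> (1 - h * \<mu> / 2) ^ N" using h\<mu> by simp
      qed
      also have "\<dots> = \<epsilon> / 4" using L R assms(3) by (simp add: \<kappa>_def)
      finally have "E (X N) \<le> \<epsilon> / 4" .
      moreover have "\<epsilon> / 2 < E (X N)"
      proof -
        have "0 \<le> \<mu> / 2 * (norm2 (X N - x0))\<^sup>2" using \<mu>(1) by simp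
        then show ?thesis using gap[of N] \<mu>(2) Req by (simp add: E_def)
      qed
      ultimately show False using assms(3) by linarith
    qed
    then obtain k where "k \<le> N" "f (X k) - f xs \<le> \<epsilon>" by blast
    moreover have "real N \<le> 12 * ((1 + \<alpha>)^2 / (1 - \<alpha>)^6) * (L * R\<^sup>2 / \<epsilon>) * ln (2 * L * R\<^sup>2 / \<epsilon>) + 1"
      using N(2) by (simp add: B_def \<kappa>_def mult.assoc)
    ultimately show "\<exists>N::nat.
         real N \<le> 12 * ((1 + \<alpha>)^2 / (1 - \<alpha>)^6) * (L * (norm2 (x0 - xs))\<^sup>2 / \<epsilon>) *
           ln (2 * L * (norm2 (x0 - xs))\<^sup>2 / \<epsilon>) + 1 \<and>
         f (gd (reg_estimate gt \<mu> x0) h x0 N) - f xs \<le> \<epsilon>"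
      unfolding X_def Req by (intro exI[of _ k]) (auto intro: order_trans[of _ "real N"])
  qed
qed

end
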